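(* Let $(u(x-ct,y),v(x-ct,y))$, with profile $(u,v)\in C^2(D_L)$ and arbitrary wave speed $c\in\mathbb R$, be a traveling-wave solution of the $\beta$-plane equation in $D_L=\mathbb T_L\times[-d,d]$ with $v=0$ on $y=\pm d$. Assume that one of the following conditions holds: (i) $(\Delta u)_{\min}>0$ and $\beta\in(0,(\Delta u)_{\min})$; (ii) $\Delta u\neq0$ everywhere on $D_L$ and $\beta=0$. Then $(u(x-ct,y),v(x-ct,y))$ is a shear flow.
   Context: Let $L,d>0$, $\mathbb T_L=\mathbb R/L\mathbb Z$, $D_L=\mathbb T_L\times[-d,d]$. For a constant $\beta\ge0$, the $\beta$-plane equation on $D_L$ is $$u_t+uu_x+vu_y-\beta yv=-P_x,\quad v_t+uv_x+vv_y+\beta yu=-P_y,\quad u_x+v_y=0,$$ with boundary condition $v=0$ on $y=\pm d$ ($P$ is the pressure). A traveling-wave solution of speed $c\in\mathbb R$ is a solution (for some pressure) of the form $(u(x-ct,y),v(x-ct,y))$; $(u,v)\in C^2(D_L)$ means that the profiles are $L$-periodic in the first variable and $C^2$ up to the boundary. It is a shear flow if $v\equiv0$ on $D_L$ (so that $u$ depends only on $y$). For $f\in C(D_L)$, $f_{\min}$ is the minimum of $f$ over $D_L$; $\Delta=\partial_x^2+\partial_y^2$. *)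

theory Defs
  imports "HOL-Analysis.Analysis"
begin

text \<open>
  A function on \<open>D_L = T_L \<times> [-d,d]\<close> is represented by its \<open>L\<close>-periodic lift
  \<open>f :: real \<Rightarrow> real \<Rightarrow> real\<close>, of which only the values \<open>f x y\<close> with \<open>y \<in> {-d..d}\<close> matter.
  Time-dependent functions take the time as an additional first argument.
\<close>

definition periodic_x :: "real \<Rightarrow> real \<Rightarrow> (real \<Rightarrow> real \<Rightarrow> real) \<Rightarrow> bool" where
  "periodic_x L d f \<longleftrightarrow> (\<forall>x. \<forall>y\<in>{-d..d}. f (x + L) y = f x y)"

definition dx :: "(real \<Rightarrow> real \<Rightarrow> real) \<Rightarrow> real \<Rightarrow> real \<Rightarrow> real" where
  "dx f x y = deriv (\<lambda>s. f s y) x"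

text \<open>The derivative within \<open>{-d..d}\<close> is one-sided at the walls \<open>y = -d\<close> and \<open>y = d\<close>.\<close>

definition dy :: "real \<Rightarrow> (real \<Rightarrow> real \<Rightarrow> real) \<Rightarrow> real \<Rightarrow> real \<Rightarrow> real" where
  "dy d f x y = vector_derivative (\<lambda>s. f x s) (at y within {-d..d})"

text \<open>\<open>C^k\<close> up to the boundary: all iterated partial derivatives of order at most \<open>k\<close>, mixed ones
  in both orders, exist and are continuous on the closed strip.\<close>

definition C0_strip :: "real \<Rightarrow> (real \<Rightarrow> real \<Rightarrow> real) \<Rightarrow> bool" where
  "C0_strip d f \<longleftrightarrow> continuous_on (UNIV \<times> {-d..d}) (\<lambda>(x, y). f x y)"

definition C1_strip :: "real \<Rightarrow> (real \<Rightarrow> real \<Rightarrow> real) \<Rightarrow> bool" where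
  "C1_strip d f \<longleftrightarrow>
     C0_strip d f \<and>
     (\<forall>x. \<forall>y\<in>{-d..d}. (\<lambda>s. f s y) differentiable (at x) \<and>
                      (\<lambda>s. f x s) differentiable (at y within {-d..d})) \<and>
     C0_strip d (dx f) \<and> C0_strip d (dy d f)"

definition C2_strip :: "real \<Rightarrow> (real \<Rightarrow> real \<Rightarrow> real) \<Rightarrow> bool" where
  "C2_strip d f \<longleftrightarrow> C1_strip d f \<and> C1_strip d (dx f) \<and> C1_strip d (dy d f)"

definition laplacian :: "real \<Rightarrow> (real \<Rightarrow> real \<Rightarrow> real) \<Rightarrow> real \<Rightarrow> real \<Rightarrow> real" where
  "laplacian d f x y = dx (dx f) x y + dy d (dy d f) x y"

text \<open>The minimum exists for every continuous periodic \<open>f\<close> (when \<open>L, d > 0\<close>).\<close>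

definition strip_min :: "real \<Rightarrow> (real \<Rightarrow> real \<Rightarrow> real) \<Rightarrow> real" where
  "strip_min d f = (LEAST m. \<exists>x. \<exists>y\<in>{-d..d}. m = f x y)"

text \<open>Classical solutions, for all times, of the \<open>\<beta>\<close>-plane equation with impermeable walls.
  The pressure is a function on \<open>D_L\<close> too, hence periodic.\<close>

definition beta_plane_solution ::
  "real \<Rightarrow> real \<Rightarrow> real \<Rightarrow> (real \<Rightarrow> real \<Rightarrow> real \<Rightarrow> real) \<Rightarrow> (real \<Rightarrow> real \<Rightarrow> real \<Rightarrow> real) \<Rightarrow>
   (real \<Rightarrow> real \<Rightarrow> real \<Rightarrow> real) \<Rightarrow> bool" where
  "beta_plane_solution L d \<beta> u v P \<longleftrightarrow>
     (\<forall>t. periodic_x L d (u t) \<and> periodic_x L d (v t) \<and> periodic_x L d (P t) \<and>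
          C1_strip d (u t) \<and> C1_strip d (v t) \<and> C1_strip d (P t)) \<and>
     (\<forall>t x. \<forall>y\<in>{-d..d}.
        (\<lambda>s. u s x y) differentiable (at t) \<and> (\<lambda>s. v s x y) differentiable (at t) \<and>
        deriv (\<lambda>s. u s x y) t + u t x y * dx (u t) x y + v t x y * dy d (u t) x y
          - \<beta> * y * v t x y = - dx (P t) x y \<and>
        deriv (\<lambda>s. v s x y) t + u t x y * dx (v t) x y + v t x y * dy d (v t) x y
          + \<beta> * y * u t x y = - dy d (P t) x y \<and>
        dx (u t) x y + dy d (v t) x y = 0) \<and>
     (\<forall>t x. v t x (-d) = 0 \<and> v t x d = 0)"

definition traveling :: "real \<Rightarrow> (real \<Rightarrow> real \<Rightarrow> real) \<Rightarrow> real \<Rightarrow> real \<Rightarrow> real \<Rightarrow> real" where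
  "traveling c f t x y = f (x - c * t) y"

definition traveling_wave_solution ::
  "real \<Rightarrow> real \<Rightarrow> real \<Rightarrow> real \<Rightarrow> (real \<Rightarrow> real \<Rightarrow> real) \<Rightarrow> (real \<Rightarrow> real \<Rightarrow> real) \<Rightarrow> bool" where
  "traveling_wave_solution L d \<beta> c u v \<longleftrightarrow>
     (\<exists>P. beta_plane_solution L d \<beta> (traveling c u) (traveling c v) P)"

text \<open>A flow is a shear flow when its second velocity component \<open>v\<close> vanishes; that the first
  one depends only on \<open>y\<close> is then a consequence of incompressibility.\<close>

definition shear_flow :: "real \<Rightarrow> (real \<Rightarrow> real \<Rightarrow> real \<Rightarrow> real) \<Rightarrow> bool" where
  "shear_flow d v \<longleftrightarrow> (\<forall>t x. \<forall>y\<in>{-d..d}. v t x y = 0)"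

end

theory Submission
  imports Defs
begin

text \<open>
  Eliminating the pressure gives \<open>W \<Delta>v = v (\<Delta>W + \<beta>)\<close> for \<open>W = c - u\<close>, where
  \<open>\<Delta>W + \<beta> < 0\<close> (if \<open>\<Delta>u < 0\<close> and \<open>\<beta> = 0\<close>, take \<open>W = u - c\<close>). Hence \<open>v = W w\<close> with
  \<open>w = \<Delta>v / (\<Delta>W + \<beta>)\<close> continuous on the closed strip. Where \<open>W < 0\<close>, \<open>v\<close> vanishes by the
  maximum principle for \<open>\<Delta> - (\<Delta>W + \<beta>) / W\<close>, whose zeroth-order coefficient has the good sign.
  At a zero of \<open>W\<close> that is a limit of such points, \<open>w = 0\<close> by continuity; the remaining
  zeros are local minima of \<open>W\<close>, and \<open>\<Delta>W < 0\<close> rules these out unless \<open>w = 0\<close>. So \<open>w = 0\<close>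
  on the boundary of \<open>{W > 0}\<close>. Inside, \<open>W\<close> is a positive supersolution, so \<open>w = v / W\<close>
  obeys a maximum principle and vanishes.
\<close>

section \<open>Functions on the strip\<close>

lemma C0_strip_iff:
  "C0_strip d f \<longleftrightarrow> continuous_on (UNIV \<times> {-d..d}) (\<lambda>p. f (fst p) (snd p))"
  by (simp add: C0_strip_def case_prod_unfold)

text \<open>The neighbourhood is a square, so that the two variables are bounded separately. Half
  the radius of a Euclidean ball suffices, because the distance is at most the sum of the coordinate
  distances.\<close>

lemma C0_strip_near:
  assumes "C0_strip d f" "y0 \<in> {-d..d}" "open A" "f x0 y0 \<in> A"
  obtains e where "e > 0"
    "\<And>x y. y \<in> {-d..d} \<Longrightarrow> \<bar>x - x0\<bar> < e \<Longrightarrow> \<bar>y - y0\<bar> < e \<Longrightarrow> f x y \<in> A"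
proof -
  have "continuous_on (UNIV \<times> {-d..d}) (\<lambda>p. f (fst p) (snd p))"
    using assms(1) by (simp add: C0_strip_iff)
  then obtain B where B: "open B"
      "B \<inter> (UNIV \<times> {-d..d}) = (\<lambda>p. f (fst p) (snd p)) -` A \<inter> (UNIV \<times> {-d..d})"
    using assms(3) unfolding continuous_on_open_invariant by metis
  have "(x0, y0) \<in> B"
    using B(2) assms(2,4) by auto
  then obtain r where r: "r > 0" "ball (x0, y0) r \<subseteq> B"
    using B(1) open_contains_ball by blast
  show thesis
  proof (rule that)
    show "r / 2 > 0" using r by simp
    fix x y assume y: "y \<in> {-d..d}" and close: "\<bar>x - x0\<bar> < r / 2" "\<bar>y - y0\<bar> < r / 2"
    have "dist (x0, y0) (x, y) \<le> \<bar>x - x0\<bar> + \<bar>y - y0\<bar>"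
      using sqrt_sum_squares_le_sum_abs [of "x0 - x" "y0 - y"]
      by (simp add: dist_prod_def dist_real_def abs_minus_commute)
    then have "(x, y) \<in> B" using close r(2) by (auto simp: mem_ball)
    then have "(x, y) \<in> (\<lambda>p. f (fst p) (snd p)) -` A \<inter> (UNIV \<times> {-d..d})"
      using y by (simp flip: B(2))
    then show "f x y \<in> A" by simp
  qed
qed

lemma C0_strip_near_gt:
  assumes "C0_strip d f" "y0 \<in> {-d..d}" "f x0 y0 > (a::real)"
  obtains e where "e > 0"
    "\<And>x y. y \<in> {-d..d} \<Longrightarrow> \<bar>x - x0\<bar> < e \<Longrightarrow> \<bar>y - y0\<bar> < e \<Longrightarrow> f x y > a"
  using C0_strip_near [OF assms(1,2), of "{a<..}"] assms(3) by auto

text \<open>Periodicity moves every point into the compact cell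
  \<open>{0..L} \<times> {-d..d}\<close>, where the extreme value theorem applies.\<close>

lemma strip_attains_max:
  assumes "L > 0" "d > 0" "C0_strip d f" "periodic_x L d f"
  obtains x0 y0 where "y0 \<in> {-d..d}" "\<And>x y. y \<in> {-d..d} \<Longrightarrow> f x y \<le> f x0 y0"
proof -
  have "continuous_on ({0..L} \<times> {-d..d}) (\<lambda>p. f (fst p) (snd p))"
    using assms(3) unfolding C0_strip_iff by (rule continuous_on_subset) auto
  moreover have "compact ({0..L} \<times> {-d..d})" "{0..L} \<times> {-d..d} \<noteq> {}"
    using assms by (auto intro: compact_Times)
  ultimately obtain p where p: "p \<in> {0..L} \<times> {-d..d}"
      "\<And>q. q \<in> {0..L} \<times> {-d..d} \<Longrightarrow> f (fst q) (snd q) \<le> f (fst p) (snd p)"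
    using continuous_attains_sup [of "{0..L} \<times> {-d..d}" "\<lambda>p. f (fst p) (snd p)"] by blast
  show thesis
  proof (rule that)
    show "snd p \<in> {-d..d}" using p(1) by auto
    fix x y assume y: "y \<in> {-d..d}"
    interpret periodic_fun_simple "\<lambda>x. f x y" L
      using assms(4) y by unfold_locales (auto simp: periodic_x_def)
    define z where "z = x - of_int \<lfloor>x / L\<rfloor> * L"
    have "of_int \<lfloor>x / L\<rfloor> * L \<le> x" "x \<le> (of_int \<lfloor>x / L\<rfloor> + 1) * L"
      using assms(1) by (simp_all add: pos_le_divide_eq [symmetric] pos_divide_le_eq [symmetric])
    then have "z \<in> {0..L}" by (auto simp: z_def algebra_simps)
    moreover have "f x y = f z y"
      by (simp add: z_def minus_of_int)
    ultimately show "f x y \<le> f (fst p) (snd p)"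
      using p(2) [of "(z, y)"] y by auto
  qed
qed

section \<open>Second derivative test\<close>

lemma mvt_within:
  fixes f :: "real \<Rightarrow> real"
  assumes "a < b" "{a..b} \<subseteq> S"
    and "\<And>z. z \<in> {a..b} \<Longrightarrow> (f has_real_derivative f' z) (at z within S)"
  obtains z where "a < z" "z < b" "f b - f a = f' z * (b - a)"
proof -
  have "\<exists>z\<in>{a<..<b}. f b - f a = f' z * (b - a)"
  proof (rule mvt_simple [OF assms(1), where f' = "\<lambda>z. (*) (f' z)"])
    fix z assume "a \<le> z" "z \<le> b"
    then show "(f has_derivative (*) (f' z)) (at z within {a..b})"
      using has_field_derivative_subset [OF assms(3,2)]
      by (simp add: has_field_derivative_def)
  qed
  then show thesis using that by auto
qed

text \<open>If \<open>D < 0\<close>, then near \<open>x\<close> the sign of \<open>f'\<close> is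
  opposite to that of \<open>s - x\<close>, and by the mean value theorem \<open>f\<close> drops
  below \<open>f x\<close>. One side is enough for this, so \<open>x\<close> may be an endpoint;
  there \<open>f' x = 0\<close> has to be assumed, as minimality does not force it.\<close>

lemma second_derivative_nonneg_at_min:
  fixes f f' :: "real \<Rightarrow> real"
  assumes "a < b" and x: "x \<in> {a..b}"
    and f: "\<And>s. s \<in> {a..b} \<Longrightarrow> (f has_real_derivative f' s) (at s within {a..b})"
    and f': "(f' has_real_derivative D) (at x within {a..b})" "f' x = 0"
    and e: "e > 0" "\<And>s. s \<in> {a..b} \<Longrightarrow> \<bar>s - x\<bar> < e \<Longrightarrow> f x \<le> f s"
  shows "D \<ge> 0"
proof (rule ccontr)
  assume "\<not> D \<ge> 0"
  then have "D < 0" by simp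
  have "((\<lambda>s. f' s / (s - x)) \<longlongrightarrow> D) (at x within {a..b})"
    using f' by (simp add: has_field_derivative_iff)
  then have "\<forall>\<^sub>F s in at x within {a..b}. f' s / (s - x) < 0"
    using \<open>D < 0\<close> by (rule order_tendstoD)
  then obtain r where r: "r > 0"
      "\<And>s. s \<in> {a..b} \<Longrightarrow> s \<noteq> x \<Longrightarrow> \<bar>s - x\<bar> < r \<Longrightarrow> f' s / (s - x) < 0"
    unfolding eventually_at by (auto simp: dist_real_def)
  \<comment> \<open>As \<open>h\<close> is at most half the length of the interval, at least one of
    \<open>x + h\<close> and \<open>x - h\<close> stays in \<open>{a..b}\<close>.\<close>
  define h where "h = min (min r e) (b - a) / 2"
  have h: "h > 0" "h < r" "h < e" "h \<le> (b - a) / 2"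
    using r(1) e(1) \<open>a < b\<close> by (auto simp: h_def)
  show False
  proof (cases "x + h \<le> b")
    case True
    obtain \<xi> where \<xi>: "x < \<xi>" "\<xi> < x + h" "f (x + h) - f x = f' \<xi> * h"
      by (rule mvt_within [of x "x + h" "{a..b}" f f']) (use h x True f in auto)
    have "f' \<xi> / (\<xi> - x) < 0" using r(2) [of \<xi>] \<xi> h x True by auto
    then have "f' \<xi> < 0" using \<xi> by (simp add: divide_less_0_iff)
    then have "f (x + h) < f x" using \<xi>(3) h(1) by (smt (verit) mult_neg_pos)
    then show False using e(2) [of "x + h"] h x True by auto
  next
    case False
    then have xh: "x - h \<ge> a" using h(4) by (simp add: field_simps)
    obtain \<xi> where \<xi>: "x - h < \<xi>" "\<xi> < x" "f x - f (x - h) = f' \<xi> * h"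
      by (rule mvt_within [of "x - h" x "{a..b}" f f']) (use h x xh f in auto)
    have "f' \<xi> / (\<xi> - x) < 0" using r(2) [of \<xi>] \<xi> h x xh by auto
    then have "f' \<xi> > 0" using \<xi> by (simp add: divide_less_0_iff)
    then have "f (x - h) < f x" using \<xi>(3) h(1) by (smt (verit) mult_pos_pos)
    then show False using e(2) [of "x - h"] h x xh by auto
  qed
qed

text \<open>The derivatives are parameters, so that for combinations such as \<open>- v\<close> or
  \<open>(m - E y) * W x y - v x y\<close> they can be given by explicit formulas and verified by
  the differentiation rules.\<close>

definition strip_derivs ::
  "real \<Rightarrow> (real \<Rightarrow> real \<Rightarrow> real) \<Rightarrow> (real \<Rightarrow> real \<Rightarrow> real) \<Rightarrow> (real \<Rightarrow> real \<Rightarrow> real) \<Rightarrow>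
   (real \<Rightarrow> real \<Rightarrow> real) \<Rightarrow> (real \<Rightarrow> real \<Rightarrow> real) \<Rightarrow> bool" where
  "strip_derivs d f fx fy fxx fyy \<longleftrightarrow>
     (\<forall>x. \<forall>y\<in>{-d..d}.
        ((\<lambda>s. f s y) has_real_derivative fx x y) (at x) \<and>
        ((\<lambda>s. f x s) has_real_derivative fy x y) (at y within {-d..d}) \<and>
        ((\<lambda>s. fx s y) has_real_derivative fxx x y) (at x) \<and>
        ((\<lambda>s. fy x s) has_real_derivative fyy x y) (at y within {-d..d}))"

lemma strip_derivsD:
  assumes "strip_derivs d f fx fy fxx fyy" "y \<in> {-d..d}"
  shows "((\<lambda>s. f s y) has_real_derivative fx x y) (at x)"
    "((\<lambda>s. f x s) has_real_derivative fy x y) (at y within {-d..d})"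
    "((\<lambda>s. fx s y) has_real_derivative fxx x y) (at x)"
    "((\<lambda>s. fy x s) has_real_derivative fyy x y) (at y within {-d..d})"
  using assms unfolding strip_derivs_def by blast+

text \<open>The variable \<open>x\<close> is unrestricted, so this also covers the walls, where the
  y-derivative at a minimum need not vanish.\<close>

lemma strip_local_min_x:
  assumes D: "strip_derivs d f fx fy fxx fyy" and y0: "y0 \<in> {-d..d}" and "e > 0"
    and min: "\<And>x y. y \<in> {-d..d} \<Longrightarrow> \<bar>x - x0\<bar> < e \<Longrightarrow> \<bar>y - y0\<bar> < e \<Longrightarrow> f x0 y0 \<le> f x y"
  shows "fx x0 y0 = 0" "fxx x0 y0 \<ge> 0"
proof -
  show fx: "fx x0 y0 = 0"
    by (rule DERIV_local_min [OF strip_derivsD(1) [OF D y0] \<open>e > 0\<close>])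
      (use min [of y0] y0 \<open>e > 0\<close> in \<open>auto simp: abs_minus_commute\<close>)
  show "fxx x0 y0 \<ge> 0"
    by (rule second_derivative_nonneg_at_min
          [where a = "x0 - 1" and b = "x0 + 1" and f = "\<lambda>s. f s y0" and f' = "\<lambda>s. fx s y0"])
      (use fx y0 \<open>e > 0\<close> min [of y0] in
        \<open>auto intro: has_field_derivative_at_within strip_derivsD [OF D y0]\<close>)
qed

lemma strip_local_min:
  assumes D: "strip_derivs d f fx fy fxx fyy" and y0: "y0 \<in> {-d<..<d}" and e: "e > 0"
    and min: "\<And>x y. y \<in> {-d..d} \<Longrightarrow> \<bar>x - x0\<bar> < e \<Longrightarrow> \<bar>y - y0\<bar> < e \<Longrightarrow> f x0 y0 \<le> f x y"
  shows "fxx x0 y0 + fyy x0 y0 \<ge> 0"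
proof -
  have y0': "y0 \<in> {-d..d}" using y0 by auto
  have "((\<lambda>s. f x0 s) has_real_derivative fy x0 y0) (at y0)"
    using strip_derivsD(2) [OF D y0'] y0 by (simp add: at_within_Icc_at)
  then have fy: "fy x0 y0 = 0"
  proof (rule DERIV_local_min [where d = "min e (min (y0 + d) (d - y0))"])
    show "\<forall>s. \<bar>y0 - s\<bar> < min e (min (y0 + d) (d - y0)) \<longrightarrow> f x0 y0 \<le> f x0 s"
    proof (intro allI impI)
      fix s assume "\<bar>y0 - s\<bar> < min e (min (y0 + d) (d - y0))"
      then have "s \<in> {-d..d}" "\<bar>s - y0\<bar> < e" by auto
      then show "f x0 y0 \<le> f x0 s" using min [of s x0] e by simp
    qed
  qed (use y0 e in auto)
  have "fyy x0 y0 \<ge> 0"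
    by (rule second_derivative_nonneg_at_min
          [where a = "-d" and b = d and f = "\<lambda>s. f x0 s" and f' = "\<lambda>s. fy x0 s"])
      (use fy y0 e min [of _ x0] in \<open>auto intro: strip_derivsD [OF D]\<close>)
  then show ?thesis using strip_local_min_x(2) [OF D y0' e min] by simp
qed

section \<open>The maximum principle\<close>

text \<open>\<open>W\<close> stands for \<open>c - u\<close> or \<open>u - c\<close>,
  \<open>v\<close> for the vertical velocity, and \<open>eq\<close> is the vorticity equation. The
  second wall condition encodes incompressibility, which makes \<open>vy\<close> a multiple of
  \<open>Wx\<close>.\<close>

locale strip_pair =
  fixes L d \<beta> :: real and W Wx Wy Wxx Wyy v vx vy vxx vyy :: "real \<Rightarrow> real \<Rightarrow> real"
  assumes L: "L > 0" and d: "d > 0" and \<beta>: "\<beta> \<ge> 0"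
    and W: "strip_derivs d W Wx Wy Wxx Wyy"
    and v: "strip_derivs d v vx vy vxx vyy"
    and C0: "C0_strip d W" "C0_strip d Wy" "C0_strip d Wxx" "C0_strip d Wyy"
      "C0_strip d vxx" "C0_strip d vyy"
    and per: "periodic_x L d W" "periodic_x L d Wy" "periodic_x L d Wxx" "periodic_x L d Wyy"
      "periodic_x L d vxx" "periodic_x L d vyy"
    and lap_W: "\<And>x y. y \<in> {-d..d} \<Longrightarrow> Wxx x y + Wyy x y < - \<beta>"
    and eq: "\<And>x y. y \<in> {-d..d} \<Longrightarrow>
      W x y * (vxx x y + vyy x y) = v x y * (Wxx x y + Wyy x y + \<beta>)"
    and wall: "\<And>x y. y \<in> {-d, d} \<Longrightarrow> v x y = 0"
      "\<And>x y. y \<in> {-d, d} \<Longrightarrow> Wx x y = 0 \<Longrightarrow> vy x y = 0"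
begin

text \<open>The quotient \<open>v / W\<close>, extended continuously across the zeros of \<open>W\<close>.\<close>

definition w :: "real \<Rightarrow> real \<Rightarrow> real" where
  "w x y = (vxx x y + vyy x y) / (Wxx x y + Wyy x y + \<beta>)"

lemma W_times_w: "y \<in> {-d..d} \<Longrightarrow> W x y * w x y = v x y"
  using eq [of y x] lap_W [of y x] by (simp add: w_def)

lemma C0_w: "C0_strip d w"
proof -
  have "Wxx x y + Wyy x y + \<beta> \<noteq> 0" if "y \<in> {-d..d}" for x y
    using lap_W [OF that, of x] by simp
  then show ?thesis
    using C0 unfolding C0_strip_iff w_def by (intro continuous_intros) auto
qed

lemma periodic_w: "periodic_x L d w"
  using per by (simp add: periodic_x_def w_def)

text \<open>Where \<open>W < 0\<close>, the claim amounts to \<open>v \<le> 0\<close>. At a positive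
  maximum of \<open>v\<close> there, the Laplacian of \<open>v\<close> is nonpositive, so the left
  side of \<open>eq\<close> is nonnegative, while \<open>lap_W\<close> makes the right side
  negative.\<close>

lemma w_nonneg_of_W_neg:
  assumes y1: "y1 \<in> {-d..d}" and "W x1 y1 < 0"
  shows "w x1 y1 \<ge> 0"
proof -
  \<comment> \<open>The truncation equals \<open>v\<close> where \<open>W < 0\<close> and is zero
    elsewhere, so a positive maximum over the whole strip lies where \<open>W < 0\<close>.\<close>
  define f where "f x y = min (W x y) 0 * w x y" for x y
  have "C0_strip d f"
    using C0(1) C0_w unfolding C0_strip_iff f_def by (intro continuous_intros)
  moreover have "periodic_x L d f"
    using per(1) periodic_w by (simp add: periodic_x_def f_def)
  ultimately obtain x0 y0 where y0: "y0 \<in> {-d..d}"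
    and max: "\<And>x y. y \<in> {-d..d} \<Longrightarrow> f x y \<le> f x0 y0"
    using strip_attains_max [OF L d] by metis
  have "f x0 y0 \<le> 0"
  proof (rule ccontr)
    assume "\<not> f x0 y0 \<le> 0"
    then have pos: "f x0 y0 > 0" by simp
    then have neg: "W x0 y0 < 0"
      by (cases "W x0 y0" "0 :: real" rule: linorder_cases) (auto simp: f_def)
    then have fv: "f x0 y0 = v x0 y0" using W_times_w [OF y0] by (simp add: f_def)
    have "y0 \<notin> {-d, d}" using wall(1) [of y0 x0] fv pos by auto
    then have y0': "y0 \<in> {-d<..<d}" using y0 by auto
    have "C0_strip d (\<lambda>x y. - W x y)"
      using C0(1) unfolding C0_strip_iff by (intro continuous_intros)
    then obtain e where e: "e > 0"
        "\<And>x y. y \<in> {-d..d} \<Longrightarrow> \<bar>x - x0\<bar> < e \<Longrightarrow> \<bar>y - y0\<bar> < e \<Longrightarrow> - W x y > 0"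
      using C0_strip_near_gt [of d "\<lambda>x y. - W x y" y0 0 x0] y0 neg by auto
    have "- vxx x0 y0 + - vyy x0 y0 \<ge> 0"
    proof (rule strip_local_min [where fxx = "\<lambda>x y. - vxx x y" and fyy = "\<lambda>x y. - vyy x y",
          OF _ y0' e(1)])
      show "strip_derivs d (\<lambda>x y. - v x y) (\<lambda>x y. - vx x y) (\<lambda>x y. - vy x y)
              (\<lambda>x y. - vxx x y) (\<lambda>x y. - vyy x y)"
        unfolding strip_derivs_def by (auto intro!: DERIV_minus strip_derivsD [OF v])
      fix x y assume y: "y \<in> {-d..d}" and close: "\<bar>x - x0\<bar> < e" "\<bar>y - y0\<bar> < e"
      have "f x y = v x y"
        using e(2) [OF y close] W_times_w [OF y, of x] by (simp add: f_def)
      then show "- v x0 y0 \<le> - v x y" using max [OF y, of x] fv by simp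
    qed
    then have "W x0 y0 * (vxx x0 y0 + vyy x0 y0) \<ge> 0"
      using neg by (simp add: mult_nonpos_nonpos)
    moreover have "v x0 y0 * (Wxx x0 y0 + Wyy x0 y0 + \<beta>) < 0"
      using fv pos lap_W [OF y0, of x0] by (simp add: mult_pos_neg)
    ultimately show False using eq [OF y0, of x0] by simp
  qed
  then have "f x1 y1 \<le> 0" using max [OF y1, of x1] by simp
  then show ?thesis
    using assms(2) by (simp add: f_def mult_le_0_iff)
qed

text \<open>If \<open>w\<close> were nonzero at a zero of \<open>W\<close>, that zero would be a local minimum of \<open>W\<close>,
  which \<open>\<Delta>W < 0\<close> excludes in the interior. At a wall it forces \<open>W\<^sub>y \<noteq> 0\<close>, whereas
  \<open>w W\<^sub>y = v\<^sub>y = 0\<close>.\<close>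

lemma w_eq_0_of_W_eq_0:
  assumes w_neg: "\<And>x y. y \<in> {-d..d} \<Longrightarrow> W x y < 0 \<Longrightarrow> w x y = 0"
    and y0: "y0 \<in> {-d..d}" and W0: "W x0 y0 = 0"
  shows "w x0 y0 = 0"
proof (rule ccontr)
  assume w0: "w x0 y0 \<noteq> 0"
  obtain e where e: "e > 0"
      "\<And>x y. y \<in> {-d..d} \<Longrightarrow> \<bar>x - x0\<bar> < e \<Longrightarrow> \<bar>y - y0\<bar> < e \<Longrightarrow> w x y \<in> - {0}"
    using C0_strip_near [OF C0_w y0, of "- {0}" x0] w0 by (auto simp: open_Compl)
  \<comment> \<open>Near the point \<open>w\<close> does not vanish, so by \<open>w_neg\<close> no
    nearby value of \<open>W\<close> is negative.\<close>
  have min: "W x0 y0 \<le> W x y" if "y \<in> {-d..d}" "\<bar>x - x0\<bar> < e" "\<bar>y - y0\<bar> < e" for x y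
    using e(2) [OF that] w_neg [OF that(1), of x] W0 by fastforce
  show False
  proof (cases "y0 \<in> {-d<..<d}")
    case True
    then show False
      using strip_local_min [OF W True e(1) min] lap_W [OF y0, of x0] \<beta> by simp
  next
    case False
    then have y0': "y0 \<in> {-d, d}" using y0 by auto
    have Wx: "Wx x0 y0 = 0" "Wxx x0 y0 \<ge> 0"
      using strip_local_min_x [OF W y0 e(1) min] by auto
    have "((\<lambda>s. w x0 s) \<longlongrightarrow> w x0 y0) (at y0 within {-d..d})"
    proof -
      have "continuous_on {-d..d} ((\<lambda>p. w (fst p) (snd p)) \<circ> (\<lambda>s. (x0, s)))"
        using C0_w unfolding C0_strip_iff
        by (intro continuous_on_compose continuous_intros) (auto elim: continuous_on_subset)
      then show ?thesis using y0 by (simp add: continuous_on_def)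
    qed
    moreover have "((\<lambda>s. (W x0 s - W x0 y0) / (s - y0)) \<longlongrightarrow> Wy x0 y0) (at y0 within {-d..d})"
      using strip_derivsD(2) [OF W y0] by (simp add: has_field_derivative_iff)
    ultimately have "((\<lambda>s. w x0 s * ((W x0 s - W x0 y0) / (s - y0))) \<longlongrightarrow> w x0 y0 * Wy x0 y0)
        (at y0 within {-d..d})"
      by (rule tendsto_mult)
    moreover have "\<forall>\<^sub>F s in at y0 within {-d..d}.
        w x0 s * ((W x0 s - W x0 y0) / (s - y0)) = (v x0 s - v x0 y0) / (s - y0)"
    proof -
      have "w x0 s * ((W x0 s - W x0 y0) / (s - y0)) = (v x0 s - v x0 y0) / (s - y0)"
        if "s \<in> {-d..d}" for s
        using W_times_w [OF that, of x0] W0 wall(1) [OF y0', of x0] by (simp add: mult.commute)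
      then show ?thesis unfolding eventually_at_filter by (intro always_eventually) blast
    qed
    ultimately have "((\<lambda>s. v x0 s) has_real_derivative w x0 y0 * Wy x0 y0) (at y0 within {-d..d})"
      unfolding has_field_derivative_iff by (rule Lim_transform_eventually)
    moreover have "((\<lambda>s. v x0 s) has_real_derivative 0) (at y0 within {-d..d})"
      using strip_derivsD(2) [OF v y0, of x0] wall(2) [OF y0' Wx(1)] by simp
    moreover have "at y0 within {-d..d} \<noteq> bot"
      using y0 d by (simp add: trivial_limit_within islimpt_Icc)
    ultimately have "w x0 y0 * Wy x0 y0 = 0"
      unfolding has_field_derivative_iff by (meson tendsto_unique)
    then have "Wy x0 y0 = 0" using w0 by simp
    \<comment> \<open>With the normal derivative zero, the second derivative test works one-sidedly
      at the wall.\<close>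
    then have "Wyy x0 y0 \<ge> 0"
      by (intro second_derivative_nonneg_at_min
            [where a = "-d" and b = d and f = "\<lambda>s. W x0 s" and f' = "\<lambda>s. Wy x0 s" and x = y0
              and e = e])
        (use d y0 e(1) min [of _ x0] in \<open>auto intro: strip_derivsD [OF W]\<close>)
    then show False using Wx lap_W [OF y0, of x0] \<beta> by simp
  qed
qed

text \<open>For \<open>W > 0\<close> the quotient satisfies \<open>W \<Delta>w + 2 \<nabla>W \<bullet> \<nabla>w = \<beta> w\<close>. The term
  \<open>\<epsilon> exp (\<alpha> y)\<close> makes a subsolution strict where \<open>W\<close> is bounded away from zero.\<close>

lemma w_le_0:
  assumes w_neg: "\<And>x y. y \<in> {-d..d} \<Longrightarrow> W x y < 0 \<Longrightarrow> w x y = 0"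
    and y1: "y1 \<in> {-d..d}"
  shows "w x1 y1 \<le> 0"
proof (rule ccontr)
  assume w1: "\<not> w x1 y1 \<le> 0"
  define k where "k = w x1 y1"
  have k: "k > 0" using w1 by (simp add: k_def)
  have W_pos: "W x y > 0" if "y \<in> {-d..d}" "w x y > 0" for x y
    using w_neg [OF that(1)] w_eq_0_of_W_eq_0 [OF w_neg that(1)] that(2)
    by (metis less_irrefl linorder_neqE_linordered_idom)
  obtain \<delta> where \<delta>: "\<delta> > 0" "\<And>x y. y \<in> {-d..d} \<Longrightarrow> w x y > k / 2 \<Longrightarrow> W x y \<ge> \<delta>"
  proof -
    \<comment> \<open>The maximum of \<open>W\<close> and \<open>k / 2 - w\<close> is positive
      everywhere by \<open>W_pos\<close>; its minimum over the strip is the required \<delta>, since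
      the second entry is negative where \<open>w > k / 2\<close>.\<close>
    define f where "f x y = - max (W x y) (k / 2 - w x y)" for x y
    have "C0_strip d f"
      using C0(1) C0_w unfolding C0_strip_iff f_def by (intro continuous_intros)
    moreover have "periodic_x L d f"
      using per(1) periodic_w by (simp add: periodic_x_def f_def)
    ultimately obtain x0 y0 where y0: "y0 \<in> {-d..d}"
      and max: "\<And>x y. y \<in> {-d..d} \<Longrightarrow> f x y \<le> f x0 y0"
      using strip_attains_max [OF L d] by metis
    have pos: "f x0 y0 < 0"
      using W_pos [OF y0, of x0] k by (cases "w x0 y0 > 0") (auto simp: f_def)
    show thesis
    proof (rule that [of "- f x0 y0"])
      show "- f x0 y0 > 0" using pos by simp
      fix x y assume "y \<in> {-d..d}" "w x y > k / 2"
      then show "- f x0 y0 \<le> W x y" using max [of y x] pos by (auto simp: f_def)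
    qed
  qed
  obtain M where M: "M \<ge> 0" "\<And>x y. y \<in> {-d..d} \<Longrightarrow> \<bar>Wy x y\<bar> \<le> M"
  proof -
    have "C0_strip d (\<lambda>x y. \<bar>Wy x y\<bar>)"
      using C0(2) unfolding C0_strip_iff by (intro continuous_intros)
    moreover have "periodic_x L d (\<lambda>x y. \<bar>Wy x y\<bar>)"
      using per(2) by (simp add: periodic_x_def)
    ultimately obtain x0 y0 where "\<And>x y. y \<in> {-d..d} \<Longrightarrow> \<bar>Wy x y\<bar> \<le> \<bar>Wy x0 y0\<bar>"
      using strip_attains_max [OF L d] by metis
    then show thesis by (intro that [of "\<bar>Wy x0 y0\<bar>"]) auto
  qed
  \<comment> \<open>Chosen so that \<open>2 * Wy + \<alpha> * W \<ge> 1\<close> wherever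
    \<open>W \<ge> \<delta>\<close>.\<close>
  define \<alpha> where "\<alpha> = (2 * M + 1) / \<delta>"
  have \<alpha>: "\<alpha> > 0" "\<alpha> * \<delta> = 2 * M + 1" using \<delta>(1) M(1) by (auto simp: \<alpha>_def)
  \<comment> \<open>The perturbation is at most \<open>k / 4\<close> on the strip, so the maximum
    point of \<open>h\<close> still has \<open>w > k / 2\<close>, hence
    \<open>W \<ge> \<delta>\<close>.\<close>
  define \<epsilon> where "\<epsilon> = k / (4 * exp (\<alpha> * d))"
  have \<epsilon>: "\<epsilon> > 0" using k by (simp add: \<epsilon>_def)
  have \<epsilon>_exp: "\<epsilon> * exp (\<alpha> * y) \<le> k / 4" if "y \<in> {-d..d}" for y
  proof -
    have "\<epsilon> * exp (\<alpha> * y) \<le> \<epsilon> * exp (\<alpha> * d)"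
      using that \<epsilon> \<alpha>(1) by simp
    then show ?thesis by (simp add: \<epsilon>_def)
  qed
  define h where "h x y = w x y + \<epsilon> * exp (\<alpha> * y)" for x y
  have "C0_strip d h"
    using C0_w unfolding C0_strip_iff h_def by (intro continuous_intros)
  moreover have "periodic_x L d h"
    using periodic_w by (simp add: periodic_x_def h_def)
  ultimately obtain x0 y0 where y0: "y0 \<in> {-d..d}"
    and max: "\<And>x y. y \<in> {-d..d} \<Longrightarrow> h x y \<le> h x0 y0"
    using strip_attains_max [OF L d] by metis
  define m where "m = h x0 y0"
  have "m > k"
    using max [OF y1, of x1] \<epsilon> by (simp add: m_def h_def k_def) (smt (verit) exp_gt_zero mult_pos_pos)
  then have w0: "w x0 y0 > k / 2"
    using \<epsilon>_exp [OF y0] k by (simp add: m_def h_def)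
  then have W0: "W x0 y0 > 0" using W_pos [OF y0] k by simp
  have "y0 \<notin> {-d, d}"
    using wall(1) [of y0 x0] W_times_w [OF y0, of x0] W0 w0 k by auto
  then have y0': "y0 \<in> {-d<..<d}" using y0 by auto
  obtain e where e: "e > 0"
      "\<And>x y. y \<in> {-d..d} \<Longrightarrow> \<bar>x - x0\<bar> < e \<Longrightarrow> \<bar>y - y0\<bar> < e \<Longrightarrow> W x y > 0"
    using C0_strip_near_gt [OF C0(1) y0 W0] by blast
  define E where "E y = \<epsilon> * exp (\<alpha> * y)" for y
  have E: "(E has_real_derivative \<alpha> * E y) (at y within S)" for y S
    unfolding E_def by (auto intro!: derivative_eq_intros)
  \<comment> \<open>Second derivatives of \<open>w\<close> are not at hand, so
    \<open>h \<le> m\<close> is multiplied by \<open>W\<close>: near the maximum point of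
    \<open>h\<close>, \<open>?g\<close> is \<open>W * (m - h) \<ge> 0\<close> with equality at that
    point, and it involves only \<open>W\<close>, \<open>v\<close> and \<open>E\<close>.\<close>
  let ?g = "\<lambda>x y. (m - E y) * W x y - v x y"
  let ?gx = "\<lambda>x y. (m - E y) * Wx x y - vx x y"
  let ?gy = "\<lambda>x y. (m - E y) * Wy x y - \<alpha> * E y * W x y - vy x y"
  let ?gxx = "\<lambda>x y. (m - E y) * Wxx x y - vxx x y"
  let ?gyy = "\<lambda>x y. (m - E y) * Wyy x y - 2 * \<alpha> * E y * Wy x y - \<alpha>\<^sup>2 * E y * W x y - vyy x y"
  have g: "?g x y = W x y * (m - h x y)" if "y \<in> {-d..d}" for x y
    by (simp add: W_times_w [OF that, symmetric] h_def E_def algebra_simps)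
  have "?gxx x0 y0 + ?gyy x0 y0 \<ge> 0"
  proof (rule strip_local_min [where fxx = ?gxx and fyy = ?gyy, OF _ y0' e(1)])
    show "strip_derivs d ?g ?gx ?gy ?gxx ?gyy"
      unfolding strip_derivs_def
      by (auto intro!: derivative_eq_intros E strip_derivsD [OF v] strip_derivsD [OF W]
          simp: power2_eq_square algebra_simps)
    fix x y assume y: "y \<in> {-d..d}" and close: "\<bar>x - x0\<bar> < e" "\<bar>y - y0\<bar> < e"
    have "0 \<le> W x y * (m - h x y)"
      using e(2) [OF y close] max [OF y, of x] by (simp add: m_def)
    then show "?g x0 y0 \<le> ?g x y"
      by (simp only: g [OF y] g [OF y0]) (simp add: m_def)
  qed
  moreover have "m - E y0 = w x0 y0" by (simp add: m_def h_def E_def)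
  moreover have "vxx x0 y0 + vyy x0 y0 = w x0 y0 * (Wxx x0 y0 + Wyy x0 y0 + \<beta>)"
    using lap_W [OF y0, of x0] by (simp add: w_def)
  \<comment> \<open>In the Laplacian of \<open>?g\<close> the terms \<open>w * (Wxx + Wyy)\<close>
    cancel, leaving minus the expression below.\<close>
  ultimately have "\<alpha> * E y0 * (2 * Wy x0 y0 + \<alpha> * W x0 y0) + \<beta> * w x0 y0 \<le> 0"
    by (simp add: algebra_simps power2_eq_square)
  moreover have "2 * Wy x0 y0 + \<alpha> * W x0 y0 > 0"
  proof -
    have "\<alpha> * W x0 y0 \<ge> 2 * M + 1"
      using \<delta>(2) [OF y0 w0] \<alpha> by (metis less_imp_le mult_left_mono)
    then show ?thesis using M(2) [OF y0, of x0] by simp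
  qed
  then have "\<alpha> * E y0 * (2 * Wy x0 y0 + \<alpha> * W x0 y0) > 0"
    using \<alpha>(1) \<epsilon> by (simp add: E_def)
  moreover have "\<beta> * w x0 y0 \<ge> 0" using \<beta> w0 k by simp
  ultimately show False by simp
qed

end

text \<open>The hypotheses are invariant under \<open>v \<mapsto> - v\<close>, which turns
  \<open>w\<close> into \<open>- w\<close>, so each one-sided bound yields an equality: first where
  \<open>W < 0\<close>, then everywhere.\<close>

lemma (in strip_pair) v_eq_0:
  assumes y: "y \<in> {-d..d}"
  shows "v x y = 0"
proof -
  interpret neg: strip_pair L d \<beta> W Wx Wy Wxx Wyy "\<lambda>x y. - v x y" "\<lambda>x y. - vx x y"
    "\<lambda>x y. - vy x y" "\<lambda>x y. - vxx x y" "\<lambda>x y. - vyy x y"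
  proof
    show "strip_derivs d (\<lambda>x y. - v x y) (\<lambda>x y. - vx x y) (\<lambda>x y. - vy x y)
            (\<lambda>x y. - vxx x y) (\<lambda>x y. - vyy x y)"
      unfolding strip_derivs_def by (auto intro!: DERIV_minus strip_derivsD [OF v])
    show "C0_strip d (\<lambda>x y. - vxx x y)" "C0_strip d (\<lambda>x y. - vyy x y)"
      using C0 unfolding C0_strip_iff by (auto intro!: continuous_intros)
    show "periodic_x L d (\<lambda>x y. - vxx x y)" "periodic_x L d (\<lambda>x y. - vyy x y)"
      using per by (auto simp: periodic_x_def)
    fix x y assume "y \<in> {-d..d}"
    from eq [OF this, of x]
    show "W x y * (- vxx x y + - vyy x y) = - v x y * (Wxx x y + Wyy x y + \<beta>)"
      by (simp add: algebra_simps)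
  qed (use L d \<beta> W C0 per lap_W wall in auto)
  have neg_w: "neg.w x y = - w x y" for x y
    by (simp add: neg.w_def w_def divide_simps)
  have "w x y = 0" if "y \<in> {-d..d}" "W x y < 0" for x y
    using w_nonneg_of_W_neg [OF that] neg.w_nonneg_of_W_neg [OF that] by (simp add: neg_w)
  then have "w x y = 0"
    using w_le_0 [OF _ y, of x] neg.w_le_0 [OF _ y, of x] by (force simp: neg_w)
  then show ?thesis using W_times_w [OF y, of x] by simp
qed

section \<open>The vorticity equation\<close>

lemma C1_stripD:
  assumes "C1_strip d f" "y \<in> {-d..d}"
  shows "((\<lambda>s. f s y) has_real_derivative dx f x y) (at x)"
    "((\<lambda>s. f x s) has_real_derivative dy d f x y) (at y within {-d..d})"
proof -
  have "(\<lambda>s. f s y) differentiable at x" "(\<lambda>s. f x s) differentiable at y within {-d..d}"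
    using assms unfolding C1_strip_def by blast+
  then show "((\<lambda>s. f s y) has_real_derivative dx f x y) (at x)"
    "((\<lambda>s. f x s) has_real_derivative dy d f x y) (at y within {-d..d})"
    unfolding dx_def dy_def
    by (simp_all add: DERIV_deriv_iff_real_differentiable
        has_real_derivative_iff_has_vector_derivative vector_derivative_works [symmetric])
       (simp add: DERIV_deriv_iff_real_differentiable
        flip: has_real_derivative_iff_has_vector_derivative)
qed

lemma C2_strip_derivs:
  assumes "C2_strip d f"
  shows "strip_derivs d f (dx f) (dy d f) (dx (dx f)) (dy d (dy d f))"
  using assms unfolding C2_strip_def strip_derivs_def by (auto intro: C1_stripD)

lemma dy_unique:
  assumes "(f x has_real_derivative D) (at y within {-d..d})" "d > 0" "y \<in> {-d..d}"
  shows "dy d f x y = D"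
  unfolding dy_def using assms
  by (intro vector_derivative_within)
    (auto simp: has_real_derivative_iff_has_vector_derivative trivial_limit_within islimpt_Icc)

lemma periodic_dx:
  assumes "C1_strip d f" "periodic_x L d f"
  shows "periodic_x L d (dx f)"
  unfolding periodic_x_def
proof (intro allI ballI)
  fix x y assume y: "y \<in> {-d..d}"
  have "((\<lambda>s. f (s + L) y) has_real_derivative dx f (x + L) y) (at x)"
    using C1_stripD(1) [OF assms(1) y, of "x + L"] by (simp add: DERIV_shift)
  moreover have "(\<lambda>s. f (s + L) y) = (\<lambda>s. f s y)"
    using assms(2) y by (auto simp: periodic_x_def)
  ultimately show "dx f (x + L) y = dx f x y"
    using C1_stripD(1) [OF assms(1) y, of x] by (metis DERIV_unique)
qed

lemma periodic_dy:
  assumes "d > 0" "C1_strip d f" "periodic_x L d f"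
  shows "periodic_x L d (dy d f)"
  unfolding periodic_x_def
proof (intro allI ballI)
  fix x y assume y: "y \<in> {-d..d}"
  have "(f (x + L) has_real_derivative dy d f x y) (at y within {-d..d})"
    using C1_stripD(2) [OF assms(2) y, of x]
    by (rule has_field_derivative_transform_within [OF _ zero_less_one y])
      (use assms(3) in \<open>auto simp: periodic_x_def\<close>)
  then show "dy d f (x + L) y = dy d f x y"
    using assms(1) y by (rule dy_unique)
qed

text \<open>Both mixed derivatives are limits of the same second difference over small rectangles,
  which may be taken to one side of a wall.\<close>

lemma mixed_derivatives_eq:
  assumes "d > 0"
    and f: "\<And>x y. y \<in> {-d..d} \<Longrightarrow> ((\<lambda>s. f s y) has_real_derivative A x y) (at x)"
      "\<And>x y. y \<in> {-d..d} \<Longrightarrow> ((\<lambda>s. f x s) has_real_derivative B x y) (at y within {-d..d})"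
    and AB: "\<And>x y. y \<in> {-d..d} \<Longrightarrow> ((\<lambda>s. A x s) has_real_derivative a x y) (at y within {-d..d})"
      "\<And>x y. y \<in> {-d..d} \<Longrightarrow> ((\<lambda>s. B s y) has_real_derivative b x y) (at x)"
    and C0: "C0_strip d a" "C0_strip d b"
    and y0: "y0 \<in> {-d..d}"
  shows "a x0 y0 = b x0 y0"
proof (rule ccontr)
  assume neq: "a x0 y0 \<noteq> b x0 y0"
  \<comment> \<open>Half the gap, so that the balls of radius \<open>r\<close> about the two values
    are disjoint.\<close>
  define r where "r = \<bar>a x0 y0 - b x0 y0\<bar> / 2"
  have r: "r > 0" using neq by (simp add: r_def)
  obtain e1 where e1: "e1 > 0" "\<And>x y. y \<in> {-d..d} \<Longrightarrow> \<bar>x - x0\<bar> < e1 \<Longrightarrow> \<bar>y - y0\<bar> < e1 \<Longrightarrow>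
      a x y \<in> ball (a x0 y0) r"
    using C0_strip_near [OF C0(1) y0, of "ball (a x0 y0) r" x0] r by auto
  obtain e2 where e2: "e2 > 0" "\<And>x y. y \<in> {-d..d} \<Longrightarrow> \<bar>x - x0\<bar> < e2 \<Longrightarrow> \<bar>y - y0\<bar> < e2 \<Longrightarrow>
      b x y \<in> ball (b x0 y0) r"
    using C0_strip_near [OF C0(2) y0, of "ball (b x0 y0) r" x0] r by auto
  define h where "h = min (min e1 e2) d / 2"
  have h: "h > 0" "h < e1" "h < e2" "h \<le> d" using e1 e2 \<open>d > 0\<close> by (auto simp: h_def)
  \<comment> \<open>The interval is clipped at the walls; it always contains \<open>y0\<close> and
    has positive length.\<close>
  define p where "p = max (-d) (y0 - h)"
  define q where "q = min d (y0 + h)"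
  have pq: "p < q" "-d \<le> p" "q \<le> d" "y0 - h \<le> p" "q \<le> y0 + h"
    using h(1) \<open>d > 0\<close> y0 by (auto simp: p_def q_def)
  \<comment> \<open>The second difference is evaluated by the mean value theorem first in
    \<open>x\<close> and then in \<open>y\<close>, and afterwards in the opposite order.\<close>
  obtain \<xi> where \<xi>: "x0 < \<xi>" "\<xi> < x0 + h"
      "(f (x0 + h) q - f (x0 + h) p) - (f x0 q - f x0 p) = (A \<xi> q - A \<xi> p) * h"
    by (rule mvt_within [of x0 "x0 + h" UNIV "\<lambda>s. f s q - f s p" "\<lambda>s. A s q - A s p"])
      (use h pq in \<open>auto intro!: DERIV_diff f\<close>)
  obtain \<eta> where \<eta>: "p < \<eta>" "\<eta> < q" "A \<xi> q - A \<xi> p = a \<xi> \<eta> * (q - p)"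
    by (rule mvt_within [of p q "{-d..d}" "A \<xi>" "a \<xi>"]) (use pq in \<open>auto intro: AB\<close>)
  obtain \<eta>' where \<eta>': "p < \<eta>'" "\<eta>' < q"
      "(f (x0 + h) q - f x0 q) - (f (x0 + h) p - f x0 p) = (B (x0 + h) \<eta>' - B x0 \<eta>') * (q - p)"
    by (rule mvt_within [of p q "{-d..d}" "\<lambda>s. f (x0 + h) s - f x0 s"
            "\<lambda>s. B (x0 + h) s - B x0 s"])
      (use pq in \<open>auto intro!: DERIV_diff f\<close>)
  obtain \<xi>' where \<xi>': "x0 < \<xi>'" "\<xi>' < x0 + h" "B (x0 + h) \<eta>' - B x0 \<eta>' = b \<xi>' \<eta>' * h"
    by (rule mvt_within [of x0 "x0 + h" UNIV "\<lambda>s. B s \<eta>'" "\<lambda>s. b s \<eta>'"])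
      (use h pq \<eta>' in \<open>auto intro: AB\<close>)
  have "a \<xi> \<eta> * (q - p) * h = b \<xi>' \<eta>' * h * (q - p)"
    using \<xi>(3) \<eta>(3) \<eta>'(3) \<xi>'(3) by (simp add: algebra_simps)
  then have "a \<xi> \<eta> = b \<xi>' \<eta>'" using h(1) pq(1) by simp
  moreover have "a \<xi> \<eta> \<in> ball (a x0 y0) r"
    by (rule e1(2)) (use \<xi> \<eta> pq h in auto)
  moreover have "b \<xi>' \<eta>' \<in> ball (b x0 y0) r"
    by (rule e2(2)) (use \<xi>' \<eta>' pq h in auto)
  ultimately show False by (auto simp: r_def dist_real_def abs_if split: if_splits)
qed

text \<open>The pressure is only \<open>C1\<close>, but the momentum equations at time 0 express its
  partial derivatives through \<open>u\<close> and \<open>v\<close>, hence as \<open>C1\<close>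
  functions; equating its mixed derivatives is taking the curl. Incompressibility then cancels the
  quadratic first-order terms and turns \<open>u\<close> and \<open>v\<close> mixed derivatives into
  pure ones.\<close>

lemma traveling_wave_vorticity_equation:
  assumes d: "d > 0" and u: "C2_strip d u" and v: "C2_strip d v"
    and sol: "traveling_wave_solution L d \<beta> c u v"
    and y0: "y0 \<in> {-d..d}"
  shows "(u x0 y0 - c) * laplacian d v x0 y0 = v x0 y0 * (laplacian d u x0 y0 - \<beta>)"
    and "dx u x0 y0 + dy d v x0 y0 = 0"
    and "v x0 (-d) = 0" "v x0 d = 0"
proof -
  obtain P where P: "beta_plane_solution L d \<beta> (traveling c u) (traveling c v) P"
    using sol by (auto simp: traveling_wave_solution_def)
  have t0: "traveling c f 0 = f" for f by (simp add: traveling_def fun_eq_iff)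
  show "v x0 (-d) = 0" "v x0 d = 0"
    using P t0 unfolding beta_plane_solution_def by metis+
  have PC1: "C1_strip d (P 0)"
    using P by (simp add: beta_plane_solution_def)
  have div: "dx u x y + dy d v x y = 0" if "y \<in> {-d..d}" for x y
    using P t0 that unfolding beta_plane_solution_def by metis
  then show "dx u x0 y0 + dy d v x0 y0 = 0" using y0 .
  have C1: "C1_strip d u" "C1_strip d v" "C1_strip d (dx u)" "C1_strip d (dx v)"
      "C1_strip d (dy d u)" "C1_strip d (dy d v)"
    using u v by (auto simp: C2_strip_def)
  \<comment> \<open>Time derivatives become \<open>- c\<close> times x-derivatives, so the advecting
    velocity is \<open>u - c\<close>.\<close>
  have dt: "deriv (\<lambda>s. traveling c f s x y) 0 = - c * dx f x y"
    if "C1_strip d f" "y \<in> {-d..d}" for f x y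
  proof (rule DERIV_imp_deriv)
    have "((\<lambda>s. f s y) has_real_derivative dx f x y) (at (x - c * 0))"
      using C1_stripD(1) [OF that] by simp
    then have "((\<lambda>s. f (x - c * s) y) has_real_derivative dx f x y * (- c)) (at 0)"
      by (rule DERIV_chain2) (auto intro!: derivative_eq_intros)
    then show "((\<lambda>s. traveling c f s x y) has_real_derivative - c * dx f x y) (at 0)"
      by (simp add: traveling_def mult.commute)
  qed
  define A where "A x y = - ((u x y - c) * dx u x y + v x y * dy d u x y - \<beta> * y * v x y)" for x y
  define B where "B x y = - ((u x y - c) * dx v x y + v x y * dy d v x y + \<beta> * y * u x y)" for x y
  have px: "dx (P 0) x y = A x y" and py: "dy d (P 0) x y = B x y" if y: "y \<in> {-d..d}" for x y
  proof -
    have "deriv (\<lambda>s. traveling c u s x y) 0 + traveling c u 0 x y * dx (traveling c u 0) x y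
        + traveling c v 0 x y * dy d (traveling c u 0) x y - \<beta> * y * traveling c v 0 x y
        = - dx (P 0) x y"
      "deriv (\<lambda>s. traveling c v s x y) 0 + traveling c u 0 x y * dx (traveling c v 0) x y
        + traveling c v 0 x y * dy d (traveling c v 0) x y + \<beta> * y * traveling c u 0 x y
        = - dy d (P 0) x y"
      using P y unfolding beta_plane_solution_def by blast+
    then show "dx (P 0) x y = A x y" "dy d (P 0) x y = B x y"
      by (simp_all add: t0 dt [OF C1(1) y] dt [OF C1(2) y] A_def B_def algebra_simps)
  qed
  define a where "a x y = - (dy d u x y * dx u x y + (u x y - c) * dy d (dx u) x y
    + dy d v x y * dy d u x y + v x y * dy d (dy d u) x y - \<beta> * v x y - \<beta> * y * dy d v x y)" for x y
  define b where "b x y = - (dx u x y * dx v x y + (u x y - c) * dx (dx v) x y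
    + dx v x y * dy d v x y + v x y * dx (dy d v) x y + \<beta> * y * dx u x y)" for x y
  have "a x0 y0 = b x0 y0"
  proof (rule mixed_derivatives_eq [where f = "P 0" and A = A and B = B and a = a and b = b, OF d _ _ _ _ _ _ y0])
    fix x y assume y: "y \<in> {-d..d}"
    show "((\<lambda>s. P 0 s y) has_real_derivative A x y) (at x)"
      "((\<lambda>s. P 0 x s) has_real_derivative B x y) (at y within {-d..d})"
      using C1_stripD [OF PC1 y, of x] by (simp_all add: px [OF y] py [OF y])
    show "((\<lambda>s. A x s) has_real_derivative a x y) (at y within {-d..d})"
      unfolding A_def a_def
      by (auto intro!: derivative_eq_intros C1_stripD(2) [OF C1(1) y] C1_stripD(2) [OF C1(2) y]
          C1_stripD(2) [OF C1(3) y] C1_stripD(2) [OF C1(5) y] simp: algebra_simps)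
    show "((\<lambda>s. B s y) has_real_derivative b x y) (at x)"
      unfolding B_def b_def
      by (auto intro!: derivative_eq_intros C1_stripD(1) [OF C1(1) y] C1_stripD(1) [OF C1(2) y]
          C1_stripD(1) [OF C1(4) y] C1_stripD(1) [OF C1(6) y] simp: algebra_simps)
  next
    show "C0_strip d a" "C0_strip d b"
      using C1 unfolding C1_strip_def C0_strip_iff a_def b_def
      by (auto intro!: continuous_intros)
  qed
  moreover have "dx (dy d v) x0 y0 = - dx (dx u) x0 y0"
  proof -
    have "(\<lambda>s. dx u s y0) = (\<lambda>s. - dy d v s y0)"
      using div [OF y0] by (auto simp: fun_eq_iff eq_neg_iff_add_eq_0)
    then have "((\<lambda>s. - dy d v s y0) has_real_derivative dx (dx u) x0 y0) (at x0)"
      using C1_stripD(1) [OF C1(3) y0] by metis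
    then show ?thesis
      using DERIV_minus [OF C1_stripD(1) [OF C1(6) y0, of x0]] by (metis DERIV_unique minus_minus)
  qed
  moreover have "dy d (dx u) x0 y0 = - dy d (dy d v) x0 y0"
  proof (rule dy_unique [OF _ d y0])
    show "(dx u x0 has_real_derivative - dy d (dy d v) x0 y0) (at y0 within {-d..d})"
      by (rule has_field_derivative_transform_within
            [OF DERIV_minus [OF C1_stripD(2) [OF C1(6) y0]] zero_less_one y0])
        (use div [of _ x0] in \<open>simp add: neg_eq_iff_add_eq_0 add.commute\<close>)
  qed
  moreover have "dx u x0 y0 = - dy d v x0 y0"
    using div [OF y0, of x0] by simp
  ultimately show "(u x0 y0 - c) * laplacian d v x0 y0 = v x0 y0 * (laplacian d u x0 y0 - \<beta>)"
    by (simp add: a_def b_def laplacian_def algebra_simps)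
qed

section \<open>Reduction of both conditions to one sign condition on the Laplacian of u\<close>

text \<open>The minimum is attained, because \<open>- f\<close> has a maximum, so the
  \<open>LEAST\<close> in \<open>strip_min\<close> denotes an actual value of
  \<open>f\<close>.\<close>

lemma strip_min_le:
  assumes "L > 0" "d > 0" "C0_strip d f" "periodic_x L d f" "y \<in> {-d..d}"
  shows "strip_min d f \<le> f x y"
proof -
  have "C0_strip d (\<lambda>x y. - f x y)" "periodic_x L d (\<lambda>x y. - f x y)"
    using assms by (auto simp: C0_strip_iff periodic_x_def intro!: continuous_intros)
  then obtain x0 y0 where *: "y0 \<in> {-d..d}" "\<And>x y. y \<in> {-d..d} \<Longrightarrow> f x0 y0 \<le> f x y"
    by (rule strip_attains_max [OF assms(1,2)]) auto
  have "strip_min d f = f x0 y0"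
    unfolding strip_min_def by (rule Least_equality) (use * in blast)+
  then show ?thesis using * assms(5) by simp
qed

text \<open>The sign \<open>\<sigma>\<close> covers both signs of \<open>\<Delta>u\<close>.\<close>

lemma traveling_wave_v_eq_0:
  assumes L: "L > 0" and d: "d > 0" and "\<beta> \<ge> 0"
    and per: "periodic_x L d u" "periodic_x L d v"
    and u: "C2_strip d u" and v: "C2_strip d v"
    and sol: "traveling_wave_solution L d \<beta> c u v"
    and \<sigma>: "\<sigma> = 1 \<or> \<sigma> = -1 \<and> \<beta> = 0"
    and lap: "\<And>x y. y \<in> {-d..d} \<Longrightarrow> \<sigma> * laplacian d u x y > \<beta>"
    and y: "y \<in> {-d..d}"
  shows "v x y = 0"
proof -
  note vort = traveling_wave_vorticity_equation [OF d u v sol]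
  have C1: "C1_strip d u" "C1_strip d v" "C1_strip d (dx u)" "C1_strip d (dx v)"
      "C1_strip d (dy d u)" "C1_strip d (dy d v)"
    using u v by (auto simp: C2_strip_def)
  interpret strip_pair L d \<beta> "\<lambda>x y. \<sigma> * (c - u x y)" "\<lambda>x y. - \<sigma> * dx u x y"
    "\<lambda>x y. - \<sigma> * dy d u x y" "\<lambda>x y. - \<sigma> * dx (dx u) x y" "\<lambda>x y. - \<sigma> * dy d (dy d u) x y"
    v "dx v" "dy d v" "dx (dx v)" "dy d (dy d v)"
  proof
    show "strip_derivs d (\<lambda>x y. \<sigma> * (c - u x y)) (\<lambda>x y. - \<sigma> * dx u x y)
        (\<lambda>x y. - \<sigma> * dy d u x y) (\<lambda>x y. - \<sigma> * dx (dx u) x y) (\<lambda>x y. - \<sigma> * dy d (dy d u) x y)"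
      unfolding strip_derivs_def
      by (auto intro!: derivative_eq_intros strip_derivsD [OF C2_strip_derivs [OF u]])
    show "strip_derivs d v (dx v) (dy d v) (dx (dx v)) (dy d (dy d v))"
      by (rule C2_strip_derivs [OF v])
    show "C0_strip d (\<lambda>x y. \<sigma> * (c - u x y))" "C0_strip d (\<lambda>x y. - \<sigma> * dy d u x y)"
      "C0_strip d (\<lambda>x y. - \<sigma> * dx (dx u) x y)" "C0_strip d (\<lambda>x y. - \<sigma> * dy d (dy d u) x y)"
      "C0_strip d (dx (dx v))" "C0_strip d (dy d (dy d v))"
      using C1 unfolding C1_strip_def C0_strip_iff by (auto intro!: continuous_intros)
    show "periodic_x L d (\<lambda>x y. \<sigma> * (c - u x y))" "periodic_x L d (\<lambda>x y. - \<sigma> * dy d u x y)"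
      "periodic_x L d (\<lambda>x y. - \<sigma> * dx (dx u) x y)" "periodic_x L d (\<lambda>x y. - \<sigma> * dy d (dy d u) x y)"
      "periodic_x L d (dx (dx v))" "periodic_x L d (dy d (dy d v))"
      using per periodic_dx [OF C1(1) per(1)] periodic_dy [OF d C1(1) per(1)]
        periodic_dx [OF C1(3) periodic_dx [OF C1(1) per(1)]]
        periodic_dy [OF d C1(5) periodic_dy [OF d C1(1) per(1)]]
        periodic_dx [OF C1(4) periodic_dx [OF C1(2) per(2)]]
        periodic_dy [OF d C1(6) periodic_dy [OF d C1(2) per(2)]]
      by (simp_all add: periodic_x_def)
    fix x y assume y: "y \<in> {-d..d}"
    show "- \<sigma> * dx (dx u) x y + - \<sigma> * dy d (dy d u) x y < - \<beta>"
      using lap [OF y, of x] by (simp add: laplacian_def algebra_simps)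
    \<comment> \<open>Multiplying the vorticity equation by \<open>- \<sigma>\<close> produces
      \<open>\<sigma> * \<beta>\<close> in place of \<beta>; the two agree since \<sigma> is 1 or
      \<beta> is 0.\<close>
    show "\<sigma> * (c - u x y) * (dx (dx v) x y + dy d (dy d v) x y) =
        v x y * (- \<sigma> * dx (dx u) x y + - \<sigma> * dy d (dy d u) x y + \<beta>)"
      using vort(1) [OF y, of x] \<sigma> by (auto simp: laplacian_def algebra_simps)
  next
    fix x y assume y: "y \<in> {-d, d}"
    then have y': "y \<in> {-d..d}" using d by auto
    show "v x y = 0" using vort(3,4) [OF y', of x] y by auto
    show "- \<sigma> * dx u x y = 0 \<Longrightarrow> dy d v x y = 0"
      using vort(2) [OF y', of x] \<sigma> by auto
  qed (use L d \<open>\<beta> \<ge> 0\<close> in auto)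
  show ?thesis using v_eq_0 [OF y] .
qed

theorem theorem3p10:
  fixes L d \<beta> c :: real and u v :: "real \<Rightarrow> real \<Rightarrow> real"
  assumes "L > 0" and "d > 0" and "\<beta> \<ge> 0"
    and "periodic_x L d u" and "periodic_x L d v"
    and "C2_strip d u" and "C2_strip d v"
    and "traveling_wave_solution L d \<beta> c u v"
    and "(strip_min d (laplacian d u) > 0 \<and> \<beta> \<in> {0<..<strip_min d (laplacian d u)}) \<or>
         ((\<forall>x. \<forall>y\<in>{-d..d}. laplacian d u x y \<noteq> 0) \<and> \<beta> = 0)"
  shows "shear_flow d (traveling c v)"
proof -
  note v_zero = traveling_wave_v_eq_0 [OF assms(1-8)]
  have C1: "C1_strip d u" "C1_strip d (dx u)" "C1_strip d (dy d u)"
    using assms(6) by (auto simp: C2_strip_def)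
  have lap_C0: "C0_strip d (laplacian d u)"
    using C1 unfolding C1_strip_def C0_strip_iff laplacian_def by (auto intro!: continuous_intros)
  have lap_per: "periodic_x L d (laplacian d u)"
    using periodic_dx [OF C1(2) periodic_dx [OF C1(1) assms(4)]]
      periodic_dy [OF assms(2) C1(3) periodic_dy [OF assms(2) C1(1) assms(4)]]
    by (simp add: periodic_x_def laplacian_def)
  have "v x y = 0" if y: "y \<in> {-d..d}" for x y
    using assms(9)
  proof
    assume "strip_min d (laplacian d u) > 0 \<and> \<beta> \<in> {0<..<strip_min d (laplacian d u)}"
    then have "1 * laplacian d u x y > \<beta>" if "y \<in> {-d..d}" for x y
      using strip_min_le [OF assms(1,2) lap_C0 lap_per that, of x] by simp
    then show ?thesis using v_zero [where \<sigma> = 1] y by blast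
  next
    assume *: "(\<forall>x. \<forall>y\<in>{-d..d}. laplacian d u x y \<noteq> 0) \<and> \<beta> = 0"
    \<comment> \<open>A continuous function without zeros on the connected strip has one sign, which
      then selects \<sigma>.\<close>
    have conn: "connected ((\<lambda>p. laplacian d u (fst p) (snd p)) ` (UNIV \<times> {-d..d}))"
      using lap_C0 unfolding C0_strip_iff
      by (intro connected_continuous_image) (auto intro: connected_Times)
    have zero: "0 \<notin> (\<lambda>p. laplacian d u (fst p) (snd p)) ` (UNIV \<times> {-d..d})"
      using * by force
    have sign: "\<not> (laplacian d u x y < 0 \<and> laplacian d u x' y' > 0)"
      if "y \<in> {-d..d}" "y' \<in> {-d..d}" for x y x' y'
    proof
      assume "laplacian d u x y < 0 \<and> laplacian d u x' y' > 0"
      moreover have "laplacian d u a b \<in> (\<lambda>p. laplacian d u (fst p) (snd p)) ` (UNIV \<times> {-d..d})"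
        if "b \<in> {-d..d}" for a b
        using that by (intro image_eqI [of _ _ "(a, b)"]) auto
      ultimately show False
        using connectedD_interval [OF conn, of "laplacian d u x y" "laplacian d u x' y'" 0] that
          zero by simp
    qed
    have nonzero: "laplacian d u a b \<noteq> 0" if "b \<in> {-d..d}" for a b
      using * that by blast
    show ?thesis
    proof (cases "laplacian d u x y > 0")
      case True
      then have "1 * laplacian d u x' y' > \<beta>" if "y' \<in> {-d..d}" for x' y'
        using sign [OF that y, of x' x] nonzero [OF that, of x'] * by simp
      then show ?thesis using v_zero [where \<sigma> = 1] y by blast
    next
      case False
      then have "laplacian d u x y < 0" using nonzero [OF y, of x] by simp
      then have "-1 * laplacian d u x' y' > \<beta>" if "y' \<in> {-d..d}" for x' y'
        using sign [OF y that, of x x'] nonzero [OF that, of x'] * by simp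
      then show ?thesis using v_zero [where \<sigma> = "-1"] * y by blast
    qed
  qed
  then show ?thesis by (simp add: shear_flow_def traveling_def)
qed

end
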